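(* Let $b \ge 2$ and $s \ge 2$ be integers, let $\boldsymbol{e}=(e_1,\ldots,e_s)\in\mathbb{N}^s$ with $e_1\le e_2\le\cdots\le e_s$, and let $g$ be an integer with $1 \le g \le s/2$. If there exists a $(0,m,\boldsymbol{e},s)$-net in base $b$ with $m\ge e_{s-2g+1} + \cdots + e_{s-1}+ e_s$, then necessarily $$ \sum_{j=1}^g \ \sum_{1 \le i_1 < \cdots < i_j \le s} (b^{e_{i_1}}-1) \cdots (b^{e_{i_j}}-1) \le b^m -1. $$
   Context: $\mathbb{N}$ denotes the set of positive integers and $\lambda_s$ the $s$-dimensional Lebesgue measure. Elementary interval: for integers $b\ge 2$, $s\ge 1$, an interval $J\subseteq[0,1)^s$ is an elementary interval in base $b$ if $J=\prod_{i=1}^s [a_ib^{-d_i},(a_i+1)b^{-d_i})$ with integers $d_i\ge 0$ and $0\le a_i<b^{d_i}$ for $1\le i\le s$. $(u,m,\boldsymbol{e},s)$-net: let $b\ge 2$, $s\ge 1$, $0\le u\le m$ be integers and $\boldsymbol{e}=(e_1,\ldots,e_s)\in\mathbb{N}^s$. A point set $\mathcal{P}$ of $b^m$ points in $[0,1)^s$ (an indexed family; points are counted with multiplicity) is a $(u,m,\boldsymbol{e},s)$-net in base $b$ if every elementary interval $J=\prod_{i=1}^s [a_ib^{-d_i},(a_i+1)b^{-d_i})$ in base $b$, with integers $d_i\ge 0$, $0\le a_i<b^{d_i}$ and $e_i\mid d_i$ for $1\le i\le s$ and with volume $\lambda_s(J)\ge b^{u-m}$, contains exactly $b^m\lambda_s(J)$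 points of $\mathcal{P}$. *)

theory Defs
  imports "HOL-Analysis.Analysis"
begin

text \<open>
  Points of \<open>\<real>\<^sup>s\<close> are extensional functions on \<open>{1..s}\<close>. The \<open>s\<close>-dimensional Lebesgue measure is
  the \<open>s\<close>-fold product of the one-dimensional one, on Borel sets, which include all the
  intervals considered here.
\<close>

definition lebesgue_dim :: "nat \<Rightarrow> (nat \<Rightarrow> real) measure" where
  "lebesgue_dim s = (\<Pi>\<^sub>M i\<in>{1..s}. lborel)"

definition unit_cube :: "nat \<Rightarrow> (nat \<Rightarrow> real) set" where
  "unit_cube s = (\<Pi>\<^sub>E i\<in>{1..s}. {0..<1})"

text \<open>Only the values of \<open>d\<close> and \<open>a\<close> on \<open>{1..s}\<close> matter; the bound \<open>a i < b ^ d i\<close> is imposed separately.\<close>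

definition elementary_interval ::
    "nat \<Rightarrow> nat \<Rightarrow> (nat \<Rightarrow> nat) \<Rightarrow> (nat \<Rightarrow> nat) \<Rightarrow> (nat \<Rightarrow> real) set" where
  "elementary_interval b s d a =
     (\<Pi>\<^sub>E i\<in>{1..s}. {real (a i) / real b ^ d i ..< (real (a i) + 1) / real b ^ d i})"

text \<open>
  The point set is the family \<open>P 0, \<dots>, P (b ^ m - 1)\<close>; counting indices counts points with
  multiplicity. The values of \<open>P\<close> at other indices are irrelevant.
\<close>

definition is_net ::
    "nat \<Rightarrow> nat \<Rightarrow> (nat \<Rightarrow> nat) \<Rightarrow> nat \<Rightarrow> nat \<Rightarrow> (nat \<Rightarrow> nat \<Rightarrow> real) \<Rightarrow> bool" where
  "is_net u m e s b P \<longleftrightarrow>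
     2 \<le> b \<and> 1 \<le> s \<and> u \<le> m \<and> (\<forall>i\<in>{1..s}. 1 \<le> e i) \<and>
     (\<forall>n<b ^ m. P n \<in> unit_cube s) \<and>
     (\<forall>d a. (\<forall>i\<in>{1..s}. a i < b ^ d i \<and> e i dvd d i) \<longrightarrow>
        measure (lebesgue_dim s) (elementary_interval b s d a)
          \<ge> real b powi (int u - int m) \<longrightarrow>
        real (card {n. n < b ^ m \<and> P n \<in> elementary_interval b s d a})
          = real b ^ m * measure (lebesgue_dim s) (elementary_interval b s d a))"

end

theory Submission
  imports Defs
begin

text \<open>
  Reading the leading \<open>e\<^sub>i\<close> base-\<open>b\<close> digits of the \<open>i\<close>-th coordinates turns the net into a mixed
  orthogonal array with \<open>b ^ m\<close> rows, level numbers \<open>q\<^sub>i = b ^ e\<^sub>i\<close> and strength \<open>2g\<close>: any \<open>2g\<close>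
  of the \<open>e\<^sub>i\<close> add up to at most \<open>m\<close>, so the elementary intervals that prescribe these digits in at
  most \<open>2g\<close> coordinates are large enough for the net property. The inequality is the Rao bound
  for this array.

  The Rao bound is usually obtained from the linear independence of characters. Here a single
  reproducing-kernel function replaces them. Fix a row \<open>x\<^sub>0\<close>, let \<open>\<phi>\<^sub>i x = q\<^sub>i - 1\<close> if the row \<open>x\<close>
  agrees with \<open>x\<^sub>0\<close> in column \<open>i\<close> and \<open>\<phi>\<^sub>i x = - 1\<close> otherwise, and let \<open>K\<close> be the sum of the
  products \<open>\<Prod>i\<in>I. \<phi>\<^sub>i\<close> over all sets \<open>I\<close> of at most \<open>g\<close> columns. Under the uniform distribution on
  rows each \<open>\<phi>\<^sub>i\<close> has mean \<open>0\<close> and second moment \<open>q\<^sub>i - 1\<close>, and any \<open>2g\<close> columns are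
  independent; so these products are pairwise orthogonal, and with
  \<open>M = (\<Sum>I. \<Prod>i\<in>I. (q\<^sub>i - 1))\<close> the sum of \<open>K\<^sup>2\<close> over the \<open>N\<close> rows is \<open>N * M\<close>. But \<open>K x\<^sub>0 = M\<close>,
  hence \<open>M\<^sup>2 \<le> N * M\<close>, which is \<open>M \<le> N\<close>. The empty set \<open>I\<close> contributes the \<open>1\<close> that is subtracted
  from \<open>b ^ m\<close> in the theorem.

  The kernel sees the array only through the events that a row agrees with \<open>x\<^sub>0\<close> in column \<open>i\<close>.
  The bound is therefore stated for a family of events \<open>A i\<close>, with levels and strength
  expressed by the numbers of joint occurrences.
\<close>

section \<open>The Rao bound from partial independence\<close>

text \<open>
  Expectations of products factor: expanding the product leaves only counts of the events that
  all \<open>A i\<close> with \<open>i\<close> in a subset of \<open>U\<close> occur, and these are the counts given by independence.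
\<close>

lemma sum_prod_indicator_independent:
  fixes q \<alpha> \<beta> :: "'i \<Rightarrow> real"
  assumes "finite X" and "finite U"
    and indep: "\<And>S. S \<subseteq> U \<Longrightarrow> real (card {x \<in> X. \<forall>i\<in>S. A i x}) = real (card X) * (\<Prod>i\<in>S. 1 / q i)"
  shows "(\<Sum>x\<in>X. \<Prod>i\<in>U. (\<beta> i * of_bool (A i x) + \<alpha> i))
         = real (card X) * (\<Prod>i\<in>U. (\<beta> i / q i + \<alpha> i))"
proof -
  have expansion_term: "(\<Sum>x\<in>X. (\<Prod>i\<in>S. \<beta> i * of_bool (A i x)) * prod \<alpha> (U - S))
      = real (card X) * ((\<Prod>i\<in>S. \<beta> i / q i) * prod \<alpha> (U - S))" if "S \<subseteq> U" for S
  proof -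
    have "finite S" using that \<open>finite U\<close> by (rule finite_subset)
    then have ind: "(\<Prod>i\<in>S. of_bool (A i x) :: real) = of_bool (\<forall>i\<in>S. A i x)" for x
      by (induction S) auto
    have "(\<Sum>x\<in>X. (\<Prod>i\<in>S. \<beta> i * of_bool (A i x)) * prod \<alpha> (U - S))
        = (\<Sum>x\<in>X. of_bool (\<forall>i\<in>S. A i x)) * (prod \<beta> S * prod \<alpha> (U - S))"
      unfolding prod.distrib ind by (simp add: sum_distrib_left mult_ac del: sum_of_bool_eq)
    also have "(\<Sum>x\<in>X. of_bool (\<forall>i\<in>S. A i x) :: real) = real (card {x \<in> X. \<forall>i\<in>S. A i x})"
      using \<open>finite X\<close> by (simp add: Int_def)
    also have "\<dots> = real (card X) * (\<Prod>i\<in>S. 1 / q i)" using that by (rule indep)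
    finally show ?thesis by (simp add: prod_dividef)
  qed
  have "(\<Sum>x\<in>X. \<Prod>i\<in>U. (\<beta> i * of_bool (A i x) + \<alpha> i))
      = (\<Sum>S\<in>Pow U. \<Sum>x\<in>X. (\<Prod>i\<in>S. \<beta> i * of_bool (A i x)) * prod \<alpha> (U - S))"
    unfolding prod_add[OF \<open>finite U\<close>] by (rule sum.swap)
  also have "\<dots> = (\<Sum>S\<in>Pow U. real (card X) * ((\<Prod>i\<in>S. \<beta> i / q i) * prod \<alpha> (U - S)))"
    using expansion_term by (intro sum.cong) auto
  also have "\<dots> = real (card X) * (\<Prod>i\<in>U. (\<beta> i / q i + \<alpha> i))"
    unfolding prod_add[OF \<open>finite U\<close>] by (simp only: sum_distrib_left)
  finally show ?thesis .
qed

text \<open>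
  An index in exactly one of \<open>I\<close> and \<open>J\<close> contributes a factor of mean \<open>0\<close>; an index in both
  contributes the second moment of \<open>q i * of_bool (A i x) - 1\<close>, which is \<open>q i - 1\<close>.
\<close>

lemma sum_prod_centred_orthogonal:
  fixes q :: "'i \<Rightarrow> real"
  assumes "finite X" and "finite I" and "finite J"
    and q: "\<And>i. i \<in> I \<union> J \<Longrightarrow> q i \<noteq> 0"
    and indep: "\<And>S. S \<subseteq> I \<union> J \<Longrightarrow>
      real (card {x \<in> X. \<forall>i\<in>S. A i x}) = real (card X) * (\<Prod>i\<in>S. 1 / q i)"
  shows "(\<Sum>x\<in>X. (\<Prod>i\<in>I. (q i * of_bool (A i x) - 1)) * (\<Prod>i\<in>J. (q i * of_bool (A i x) - 1)))
         = (if I = J then real (card X) * (\<Prod>i\<in>I. (q i - 1)) else 0)"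
proof -
  \<comment> \<open>A product of one or two factors \<open>q i * of_bool (A i x) - 1\<close> is again affine in the indicator;
      on \<open>I \<inter> J\<close> the square has slope \<open>q i * (q i - 2)\<close>.\<close>
  define \<alpha> :: "'i \<Rightarrow> real" where "\<alpha> i = (if i \<in> I \<inter> J then 1 else - 1)" for i
  define \<beta> where "\<beta> i = (if i \<in> I \<inter> J then q i * (q i - 2) else q i)" for i
  have fin: "finite (I \<union> J)" using assms by simp
  have extend: "prod f K = (\<Prod>i\<in>I \<union> J. if i \<in> K then f i else 1)"
    if "K \<subseteq> I \<union> J" for K and f :: "'i \<Rightarrow> real"
    using that fin by (simp add: prod.inter_restrict[symmetric] Int_absorb1)
  have "(\<Prod>i\<in>I. (q i * of_bool (A i x) - 1)) * (\<Prod>i\<in>J. (q i * of_bool (A i x) - 1))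
      = (\<Prod>i\<in>I \<union> J. (\<beta> i * of_bool (A i x) + \<alpha> i))" for x
    unfolding extend[OF Un_upper1] extend[OF Un_upper2] prod.distrib[symmetric]
    by (intro prod.cong) (auto simp: \<alpha>_def \<beta>_def algebra_simps)
  then have "(\<Sum>x\<in>X. (\<Prod>i\<in>I. (q i * of_bool (A i x) - 1)) * (\<Prod>i\<in>J. (q i * of_bool (A i x) - 1)))
      = real (card X) * (\<Prod>i\<in>I \<union> J. (\<beta> i / q i + \<alpha> i))"
    using sum_prod_indicator_independent[OF \<open>finite X\<close> fin indep] by simp
  also have "(\<Prod>i\<in>I \<union> J. (\<beta> i / q i + \<alpha> i)) = (\<Prod>i\<in>I \<union> J. if i \<in> I \<inter> J then q i - 1 else 0)"
    using q by (intro prod.cong) (auto simp: \<alpha>_def \<beta>_def)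
  also have "\<dots> = (if I = J then \<Prod>i\<in>I. (q i - 1) else 0)"
  proof (cases "I = J")
    case False
    then have "\<exists>i\<in>I \<union> J. i \<notin> I \<inter> J" by blast
    with fin have "(\<Prod>i\<in>I \<union> J. if i \<in> I \<inter> J then q i - 1 else 0) = 0"
      by (intro prod_zero) auto
    with False show ?thesis by simp
  qed simp
  finally show ?thesis by simp
qed

text \<open>
  The products \<open>\<Phi> I\<close> below are orthogonal, and the value of \<open>\<Phi> I\<close> at \<open>x0\<close> is its mean square. So
  their sum \<open>K\<close> is, up to the factor \<open>card X\<close>, the reproducing kernel at \<open>x0\<close> of their span, and
  comparing its value at \<open>x0\<close> with its squared norm gives the bound.
\<close>

lemma rao_bound:
  fixes q :: "'i \<Rightarrow> real"
  assumes "finite X" and "finite F" and "x0 \<in> X"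
    and x0: "\<And>i. i \<in> F \<Longrightarrow> A i x0"
    and q: "\<And>i. i \<in> F \<Longrightarrow> q i \<ge> 1"
    and indep: "\<And>S. S \<subseteq> F \<Longrightarrow> card S \<le> 2 * g \<Longrightarrow>
      real (card {x \<in> X. \<forall>i\<in>S. A i x}) = real (card X) * (\<Prod>i\<in>S. 1 / q i)"
  shows "(\<Sum>I | I \<subseteq> F \<and> card I \<le> g. \<Prod>i\<in>I. (q i - 1)) \<le> real (card X)"
proof -
  define \<F> where "\<F> = {I. I \<subseteq> F \<and> card I \<le> g}"
  define \<Phi> where "\<Phi> I x = (\<Prod>i\<in>I. (q i * of_bool (A i x) - 1))" for I x
  define K where "K x = (\<Sum>I\<in>\<F>. \<Phi> I x)" for x
  define M where "M = (\<Sum>I\<in>\<F>. \<Prod>i\<in>I. (q i - 1))"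
  have fin\<F>: "finite \<F>" using \<open>finite F\<close> by (simp add: \<F>_def)
  have fin: "finite I" if "I \<in> \<F>" for I
    using that \<open>finite F\<close> by (auto simp: \<F>_def intro: finite_subset)
  have "K x0 = M"
    unfolding K_def M_def \<Phi>_def using x0 by (intro sum.cong prod.cong) (auto simp: \<F>_def)
  have orth: "(\<Sum>x\<in>X. \<Phi> I x * \<Phi> J x)
      = (if I = J then real (card X) * (\<Prod>i\<in>I. (q i - 1)) else 0)" if "I \<in> \<F>" "J \<in> \<F>" for I J
    unfolding \<Phi>_def
  proof (rule sum_prod_centred_orthogonal)
    fix S assume S: "S \<subseteq> I \<union> J"
    have "card S \<le> card (I \<union> J)" using S that fin by (simp add: card_mono)
    also have "\<dots> \<le> card I + card J" by (rule card_Un_le)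
    also have "\<dots> \<le> 2 * g" using that by (simp add: \<F>_def)
    finally show "real (card {x \<in> X. \<forall>i\<in>S. A i x}) = real (card X) * (\<Prod>i\<in>S. 1 / q i)"
      using S that by (intro indep) (auto simp: \<F>_def)
  next
    fix i assume "i \<in> I \<union> J"
    then have "q i \<ge> 1" using that q by (auto simp: \<F>_def)
    then show "q i \<noteq> 0" by simp
  qed (use that fin \<open>finite X\<close> in auto)
  have "(\<Sum>x\<in>X. (K x)\<^sup>2) = (\<Sum>x\<in>X. \<Sum>I\<in>\<F>. \<Sum>J\<in>\<F>. \<Phi> I x * \<Phi> J x)"
    by (simp add: K_def power2_eq_square sum_product)
  also have "\<dots> = (\<Sum>I\<in>\<F>. \<Sum>J\<in>\<F>. \<Sum>x\<in>X. \<Phi> I x * \<Phi> J x)"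
    by (subst sum.swap) (rule sum.cong[OF refl], rule sum.swap)
  also have "\<dots> = (\<Sum>I\<in>\<F>. \<Sum>J\<in>\<F>. if I = J then real (card X) * (\<Prod>i\<in>I. (q i - 1)) else 0)"
    using orth by (intro sum.cong) auto
  also have "\<dots> = real (card X) * M"
    using fin\<F> by (simp add: M_def sum_distrib_left)
  finally have norm_K: "(\<Sum>x\<in>X. (K x)\<^sup>2) = real (card X) * M" .
  have "M\<^sup>2 \<le> (\<Sum>x\<in>X. (K x)\<^sup>2)"
    using member_le_sum[of x0 X "\<lambda>x. (K x)\<^sup>2"] \<open>x0 \<in> X\<close> \<open>finite X\<close> \<open>K x0 = M\<close> by simp
  with norm_K have "M * M \<le> real (card X) * M" by (simp add: power2_eq_square)
  moreover have "M > 0"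
  proof -
    have "(\<Prod>i\<in>{}. (q i - 1)) \<le> M"
      unfolding M_def using fin\<F> q
      by (intro member_le_sum prod_nonneg) (auto simp: \<F>_def)
    then show ?thesis by simp
  qed
  ultimately show ?thesis by (simp add: M_def \<F>_def)
qed

section \<open>The orthogonal array of a net\<close>

lemma measure_elementary_interval:
  assumes "b > 0"
  shows "measure (lebesgue_dim s) (elementary_interval b s d a) = (\<Prod>i\<in>{1..s}. 1 / real b ^ d i)"
proof -
  interpret product_sigma_finite "\<lambda>_. lborel :: real measure"
    by (simp add: product_sigma_finite_def sigma_finite_lborel)
  have "real (a i) / real b ^ d i \<le> (real (a i) + 1) / real b ^ d i" for i
    by (simp add: divide_right_mono)
  then show ?thesis
    unfolding lebesgue_dim_def elementary_interval_def measure_def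
    by (subst emeasure_PiM)
       (auto simp: prod_ennreal diff_divide_distrib[symmetric] prod_nonneg intro!: prod.cong)
qed

text \<open>
  Coordinates outside \<open>S\<close> are left free by taking \<open>d i = 0\<close> there, which every \<open>e i\<close> divides.
\<close>

lemma net_count_prescribed_digits:
  assumes net: "is_net 0 m e s b P"
    and S: "S \<subseteq> {1..s}" and large: "(\<Sum>i\<in>S. e i) \<le> m"
    and a: "\<And>i. i \<in> S \<Longrightarrow> a i < b ^ e i"
  shows "real (card {n \<in> {..<b ^ m}. \<forall>i\<in>S. P n i \<in> {real (a i) / real b ^ e i ..< (real (a i) + 1) / real b ^ e i}})
    = real b ^ m * (\<Prod>i\<in>S. 1 / real b ^ e i)"
proof -
  have b: "b \<ge> 2" and cube: "\<And>n. n < b ^ m \<Longrightarrow> P n \<in> unit_cube s"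
    using net by (auto simp: is_net_def)
  define d where "d i = (if i \<in> S then e i else 0)" for i
  define a' where "a' i = (if i \<in> S then a i else 0)" for i
  have "(\<Prod>i\<in>{1..s}. 1 / real b ^ d i) = (\<Prod>i\<in>{1..s}. if i \<in> S then 1 / real b ^ e i else 1)"
    by (intro prod.cong) (auto simp: d_def)
  also have "\<dots> = (\<Prod>i\<in>S. 1 / real b ^ e i)"
    using S by (simp add: prod.inter_restrict[symmetric] Int_absorb1)
  finally have vol: "measure (lebesgue_dim s) (elementary_interval b s d a') = (\<Prod>i\<in>S. 1 / real b ^ e i)"
    using b by (simp add: measure_elementary_interval)
  have "real b powi (int 0 - int m) = 1 / real b ^ m"
    using b by (simp add: power_int_minus field_simps)
  also have "\<dots> \<le> 1 / real b ^ (\<Sum>i\<in>S. e i)"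
    using b large by (intro divide_left_mono power_increasing) auto
  also have "\<dots> = (\<Prod>i\<in>S. 1 / real b ^ e i)"
    by (simp add: power_sum prod_dividef)
  finally have "real b powi (int 0 - int m) \<le> measure (lebesgue_dim s) (elementary_interval b s d a')"
    by (simp add: vol)
  moreover have "\<forall>i\<in>{1..s}. a' i < b ^ d i \<and> e i dvd d i"
    using a by (auto simp: a'_def d_def)
  ultimately have count: "real (card {n. n < b ^ m \<and> P n \<in> elementary_interval b s d a'})
      = real b ^ m * (\<Prod>i\<in>S. 1 / real b ^ e i)"
    using net unfolding is_net_def vol[symmetric] by blast
  have "P n \<in> elementary_interval b s d a' \<longleftrightarrow>
      (\<forall>i\<in>S. P n i \<in> {real (a i) / real b ^ e i ..< (real (a i) + 1) / real b ^ e i})"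
    if "n < b ^ m" for n
  proof -
    have mem: "P n i \<in> {0..<1}" if "i \<in> {1..s}" for i
      using cube[OF \<open>n < b ^ m\<close>] that unfolding unit_cube_def by (rule PiE_mem)
    have "P n \<in> extensional {1..s}"
      using cube[OF \<open>n < b ^ m\<close>] by (simp add: unit_cube_def PiE_def)
    then have "P n \<in> elementary_interval b s d a' \<longleftrightarrow>
        (\<forall>i\<in>{1..s}. P n i \<in> {real (a' i) / real b ^ d i ..< (real (a' i) + 1) / real b ^ d i})"
      unfolding elementary_interval_def PiE_iff by blast
    also have "\<dots> \<longleftrightarrow> (\<forall>i\<in>{1..s}. i \<in> S \<longrightarrow> P n i \<in> {real (a i) / real b ^ e i ..< (real (a i) + 1) / real b ^ e i})"
      using mem by (intro ball_cong) (auto simp: a'_def d_def)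
    finally show ?thesis using S by blast
  qed
  then have "{n \<in> {..<b ^ m}. \<forall>i\<in>S. P n i \<in> {real (a i) / real b ^ e i ..< (real (a i) + 1) / real b ^ e i}}
      = {n. n < b ^ m \<and> P n \<in> elementary_interval b s d a'}" by blast
  with count show ?thesis by simp
qed

lemma unit_interval_digit:
  fixes x :: real and q :: nat
  assumes "0 \<le> x" "x < 1" "q > 0"
  shows "nat \<lfloor>x * q\<rfloor> < q"
    and "x \<in> {real (nat \<lfloor>x * q\<rfloor>) / q ..< (real (nat \<lfloor>x * q\<rfloor>) + 1) / q}"
proof -
  have nonneg: "0 \<le> \<lfloor>x * q\<rfloor>" using assms by simp
  have "x * q < q" using assms by simp
  then have "\<lfloor>x * q\<rfloor> < int q" by (simp add: floor_less_iff)
  then show "nat \<lfloor>x * q\<rfloor> < q" using nonneg by linarith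
  show "x \<in> {real (nat \<lfloor>x * q\<rfloor>) / q ..< (real (nat \<lfloor>x * q\<rfloor>) + 1) / q}"
    using nonneg assms floor_correct[of "x * q"] by (simp add: field_simps)
qed

text \<open>
  Compare the two sets outside their intersection: every index of \<open>S\<close> that is not among the last
  \<open>k\<close> lies below all of those, and \<open>S\<close> has at most as many such indices as it omits of the last \<open>k\<close>.
\<close>

lemma sum_le_sum_last_of_mono:
  fixes e :: "nat \<Rightarrow> nat"
  assumes mono: "mono_on {1..s} e" and S: "S \<subseteq> {1..s}"
    and "card S \<le> k" and "1 \<le> k" and "k \<le> s"
  shows "(\<Sum>i\<in>S. e i) \<le> (\<Sum>i = s - k + 1..s. e i)"
proof -
  define t where "t = s - k + 1"
  define T where "T = {t..s}"
  have t: "1 \<le> t" "t \<le> s" and cardT: "card T = k" using assms by (auto simp: t_def T_def)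
  have finS: "finite S" using S by (rule finite_subset) simp
  have finT: "finite T" by (simp add: T_def)
  have "card (S - T) \<le> card (T - S)"
    using card_le_sym_Diff[OF finS finT] \<open>card S \<le> k\<close> cardT by simp
  have "e i \<le> e t" if "i \<in> S - T" for i
    using that S t by (intro mono_onD[OF mono]) (auto simp: T_def)
  then have "(\<Sum>i\<in>S - T. e i) \<le> card (S - T) * e t"
    using sum_bounded_above[of "S - T" e "e t"] by simp
  also have "\<dots> \<le> card (T - S) * e t"
    using \<open>card (S - T) \<le> card (T - S)\<close> by simp
  also have "\<dots> \<le> (\<Sum>i\<in>T - S. e i)"
  proof -
    have "e t \<le> e i" if "i \<in> T - S" for i
      using that t by (intro mono_onD[OF mono]) (auto simp: T_def)
    then show ?thesis using sum_bounded_below[of "T - S" "e t" e] by simp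
  qed
  finally have "(\<Sum>i\<in>S - T. e i) \<le> (\<Sum>i\<in>T - S. e i)" .
  moreover have "sum e S = sum e (S \<inter> T) + sum e (S - T)" using finS by (rule sum.Int_Diff)
  moreover have "sum e T = sum e (S \<inter> T) + sum e (T - S)"
    using sum.Int_Diff[OF finT, of e S] by (simp add: Int_commute)
  ultimately show ?thesis by (simp add: T_def t_def)
qed

section \<open>The bound for nets\<close>

lemma sum_over_small_subsets:
  fixes f :: "'i set \<Rightarrow> 'a::comm_monoid_add"
  assumes "finite F"
  shows "(\<Sum>I | I \<subseteq> F \<and> card I \<le> g. f I) = f {} + (\<Sum>j = 1..g. \<Sum>I | I \<subseteq> F \<and> card I = j. f I)"
proof -
  have "(\<Sum>I | I \<subseteq> F \<and> card I \<le> g. f I) = (\<Sum>j\<in>{0..g}. \<Sum>I | I \<in> {I. I \<subseteq> F \<and> card I \<le> g} \<and> card I = j. f I)"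
    using assms by (intro sum.group[symmetric]) auto
  also have "\<dots> = (\<Sum>j\<in>{0..g}. \<Sum>I | I \<subseteq> F \<and> card I = j. f I)"
    by (intro sum.cong) auto
  also have "\<dots> = (\<Sum>I | I \<subseteq> F \<and> card I = 0. f I) + (\<Sum>j = 1..g. \<Sum>I | I \<subseteq> F \<and> card I = j. f I)"
    by (simp add: sum.atLeast_Suc_atMost)
  also have "{I. I \<subseteq> F \<and> card I = 0} = {{}}"
    using assms by (auto dest: finite_subset)
  finally show ?thesis by simp
qed

theorem theorem2:
  fixes b s g m :: nat and e :: "nat \<Rightarrow> nat"
  assumes "b \<ge> 2" and "s \<ge> 2"
    and "\<And>i. i \<in> {1..s} \<Longrightarrow> e i \<ge> 1"
    and "mono_on {1..s} e"
    and "1 \<le> g" and "real g \<le> real s / 2"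
    and "\<exists>P. is_net 0 m e s b P"
    and "m \<ge> (\<Sum>i = s - 2 * g + 1..s. e i)"
  shows "(\<Sum>j = 1..g. \<Sum>I | I \<subseteq> {1..s} \<and> card I = j. \<Prod>i\<in>I. (int b ^ e i - 1)) \<le> int b ^ m - 1"
proof -
  obtain P where net: "is_net 0 m e s b P" using assms by blast
  \<comment> \<open>The point with index \<open>0\<close> is the reference row \<open>x\<^sub>0\<close>; \<open>a i\<close> encodes its leading \<open>e i\<close> digits.\<close>
  define a where "a i = nat \<lfloor>P 0 i * real (b ^ e i)\<rfloor>" for i
  define A where "A i n \<longleftrightarrow> P n i \<in> {real (a i) / real b ^ e i ..< (real (a i) + 1) / real b ^ e i}" for i n
  have "P 0 \<in> unit_cube s" using net \<open>b \<ge> 2\<close> by (simp add: is_net_def)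
  then have P0: "0 \<le> P 0 i" "P 0 i < 1" if "i \<in> {1..s}" for i
    using that by (auto simp: unit_cube_def PiE_iff)
  have a: "a i < b ^ e i" and A0: "A i 0" if "i \<in> {1..s}" for i
    using unit_interval_digit[OF P0[OF that], of "b ^ e i"] \<open>b \<ge> 2\<close> by (simp_all add: a_def A_def)
  have "(\<Sum>I | I \<subseteq> {1..s} \<and> card I \<le> g. \<Prod>i\<in>I. (real b ^ e i - 1)) \<le> real (card {..<b ^ m})"
  proof (rule rao_bound[where A = A and ?x0.0 = 0])
    fix S assume S: "S \<subseteq> {1..s}" "card S \<le> 2 * g"
    have "(\<Sum>i\<in>S. e i) \<le> (\<Sum>i = s - 2 * g + 1..s. e i)"
      using assms S by (intro sum_le_sum_last_of_mono) auto
    with assms have "(\<Sum>i\<in>S. e i) \<le> m" by simp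
    then show "real (card {n \<in> {..<b ^ m}. \<forall>i\<in>S. A i n})
        = real (card {..<b ^ m}) * (\<Prod>i\<in>S. 1 / real b ^ e i)"
      using net_count_prescribed_digits[OF net S(1), of a] S a by (simp add: A_def subset_iff)
  qed (use A0 \<open>b \<ge> 2\<close> in auto)
  then have "real_of_int (\<Sum>I | I \<subseteq> {1..s} \<and> card I \<le> g. \<Prod>i\<in>I. (int b ^ e i - 1))
      \<le> real_of_int (int b ^ m)"
    by simp
  then have "(\<Sum>I | I \<subseteq> {1..s} \<and> card I \<le> g. \<Prod>i\<in>I. (int b ^ e i - 1)) \<le> int b ^ m"
    by (simp only: of_int_le_iff)
  then show ?thesis by (simp add: sum_over_small_subsets)
qed

end
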